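(* Let $m=p_1p_2\cdots p_k$ be a primitive abundant number, where $p_1\le\dots\le p_k$ are primes (not necessarily distinct). Let $1\le j<k$ and let $\tilde p_j$ be a prime with $p_{j-1}<\tilde p_j<p_j$ (where $p_0:=1$) such that $p_1\cdots p_{j-1}\tilde p_j$ is deficient. Then there exist primes $\tilde p_{j+1}\le\dots\le\tilde p_k$ with $\tilde p_j\le\tilde p_{j+1}$ such that $\tilde m=p_1\cdots p_{j-1}\tilde p_j\tilde p_{j+1}\cdots\tilde p_k$ is abundant and $p_1\cdots p_{j-1}\tilde p_j\cdots\tilde p_i$ is deficient for every $i<k$ (with $i\ge j$).
   Context: For $n\in\mathbb{N}$, $\sigma(n)=\sum_{d\mid n}d$. $n$ is deficient if $\sigma(n)<2n$, perfect if $\sigma(n)=2n$, abundant if $\sigma(n)>2n$, and non-deficient if perfect or abundant. A primitive abundant number is an abundant number all of whose proper divisors are deficient. *)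

theory Defs
  imports Complex_Main "HOL-Computational_Algebra.Primes"
begin

definition divisor_sigma :: "nat \<Rightarrow> nat" where
  "divisor_sigma n = (\<Sum>d | d dvd n. d)"

text \<open>Every natural number divides \<open>0\<close>, so \<open>divisor_sigma 0 = 0\<close> as the sum over an infinite set;
  with strict inequalities, \<open>0\<close> is thus neither deficient nor abundant.\<close>

definition deficient :: "nat \<Rightarrow> bool" where
  "deficient n \<longleftrightarrow> divisor_sigma n < 2 * n"

definition abundant :: "nat \<Rightarrow> bool" where
  "abundant n \<longleftrightarrow> divisor_sigma n > 2 * n"

definition primitive_abundant :: "nat \<Rightarrow> bool" where
  "primitive_abundant n \<longleftrightarrow> abundant n \<and> (\<forall>d. d dvd n \<and> d \<noteq> n \<longrightarrow> deficient d)"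

end

theory Submission
  imports Defs
begin

text \<open>
  For deficient \<open>n\<close> put \<open>s = \<sigma>(n) / (2n - \<sigma>(n))\<close>. Keep the primes \<open>p\<^sub>l\<close> after
  \<open>q\<close> until the product first fails to be deficient, at index \<open>i\<close>; this happens because replacing
  \<open>p\<^sub>j\<close> by \<open>q\<close> in \<open>m\<close> keeps it abundant. If \<open>i = k\<close> nothing else is needed. Otherwise the product
  up to \<open>i - 1\<close> has \<open>s \<ge> p\<^sub>i \<ge> 3\<close>, and one repeatedly appends a prime \<open>p > s\<close> for which some prime
  \<open>r > p\<close> would make the product abundant. Such \<open>p\<close> and \<open>r\<close> exist as soon as there are two primes
  in \<open>(s, 2s]\<close>, a mild strengthening of Bertrand's postulate that follows from Erdos' argument.
\<close>

subsection \<open>Prime factors of binomial coefficients\<close>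

text \<open>The multiplicity of a prime in an lcm is the maximum of the multiplicities, so some
  element attains it. \<open>e > 0\<close> rules out the empty set, whose lcm is 1.\<close>

lemma prime_power_dvd_LcmD:
  fixes p :: nat
  assumes "finite A" "prime p" "p ^ e dvd Lcm A" "e > 0"
  shows "\<exists>a\<in>A. p ^ e dvd a"
  using assms(1,3)
proof (induction A rule: finite_induct)
  case empty
  then show ?case using assms(2,4) by (simp add: prime_nat_iff)
next
  case (insert a A)
  show ?case
  proof (cases "a = 0 \<or> Lcm A = 0")
    case True
    then show ?thesis using insert by auto
  next
    case False
    then have "e \<le> multiplicity p (lcm a (Lcm A))"
      using insert.prems assms(2) by (intro multiplicity_geI) (auto simp: lcm_eq_0_iff)
    also have "\<dots> = max (multiplicity p a) (multiplicity p (Lcm A))"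
      using False assms(2) by (intro multiplicity_lcm) auto
    finally have "p ^ e dvd a \<or> p ^ e dvd Lcm A"
      by (auto simp: le_max_iff_disj intro: multiplicity_dvd')
    then show ?thesis using insert.IH by auto
  qed
qed

text \<open>
  The reciprocals of \<open>L n k = Suc n * (n choose k)\<close> form Leibniz' harmonic triangle,
  \<open>1 / L n (k + 1) = 1 / L (n - 1) k - 1 / L n k\<close>, so divisibility propagates along rows.
\<close>

lemma Suc_times_binomial_dvd_Lcm:
  assumes "k \<le> n"
  shows "Suc n * (n choose k) dvd Lcm {1..Suc n}"
  using assms
proof (induction k arbitrary: n)
  case 0
  then show ?case by (auto intro: dvd_Lcm)
next
  case (Suc k)
  then obtain n' where n: "n = Suc n'" by (cases n) auto
  with Suc.prems have k: "k \<le> n'" by simp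
  let ?M = "Lcm {1..Suc n}" and ?X = "n * (n' choose k)"
  obtain u where u: "?M = Suc n * (n choose k) * u"
    using Suc.IH[of n] Suc.prems by (auto elim: dvdE)
  have "?X dvd Lcm {1..n}" using Suc.IH[OF k] n by simp
  also have "\<dots> dvd ?M" by (rule Lcm_subset) auto
  finally obtain v where v: "?M = ?X * v" by (auto elim: dvdE)
  have e1: "(n choose k) * (n - k) = ?X"
    using binomial_absorb_comp[of n k] n by (simp add: mult.commute)
  have e2: "(n choose Suc k) * Suc k = ?X"
    using Suc_times_binomial_eq[of n' k] n by simp
  define y where "y = int (n choose Suc k)"
  \<comment> \<open>Split \<open>k + 1 = (n + 1) - (n - k)\<close>. After inserting \<open>u\<close>
    and \<open>v\<close>, both terms contain \<open>?X\<close>, which by \<open>e2\<close> carries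
    the factor \<open>k + 1\<close>, so that factor cancels.\<close>
  have "int ?M * int (Suc k) = int ?M * int (Suc n) - int ?M * int (n - k)"
    using k n by (simp add: of_nat_diff algebra_simps)
  also have "\<dots> = int (?X * v) * int (Suc n) - int (Suc n * (n choose k) * u) * int (n - k)"
    by (simp only: u[symmetric] v[symmetric])
  also have "\<dots> = int ?X * int v * int (Suc n) - int (Suc n) * int ((n choose k) * (n - k)) * int u"
    by (simp only: of_nat_mult mult_ac)
  also have "\<dots> = int (Suc n) * int ?X * (int v - int u)"
    unfolding e1 by (simp add: algebra_simps)
  also have "\<dots> = int (Suc n) * y * (int v - int u) * int (Suc k)"
    unfolding e2[symmetric] y_def by (simp only: of_nat_mult mult_ac)
  finally have "int ?M = int (Suc n) * y * (int v - int u)" by simp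
  then have "int (Suc n * (n choose Suc k)) dvd int ?M"
    unfolding y_def of_nat_mult by (metis dvd_triv_left)
  then show ?case by (simp only: int_dvd_int_iff)
qed

text \<open>For \<open>k > 0\<close>, \<open>k * (n choose k) = n * ((n - 1) choose (k - 1))\<close>
  divides the lcm of \<open>1..n\<close>, so a prime power in it divides some positive number up to
  \<open>n\<close>.\<close>

lemma prime_power_dvd_binomial_le:
  assumes "prime p" "p ^ e dvd (n choose k)" "k \<le> n" "n > 0"
  shows "p ^ e \<le> n"
proof (cases "e = 0 \<or> k = 0")
  case True
  then show ?thesis using assms by (auto simp: prime_nat_iff)
next
  case False
  obtain n' k' where n: "n = Suc n'" "k = Suc k'" using assms False by (cases n; cases k) auto
  have "p ^ e dvd k * (n choose k)" using assms(2) by simp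
  also have "\<dots> = Suc n' * (n' choose k')"
    using Suc_times_binomial_eq[of n' k'] n by (simp only: mult.commute)
  also have "\<dots> dvd Lcm {1..n}"
    using Suc_times_binomial_dvd_Lcm[of k' n'] assms(3) n by simp
  finally obtain a where "a \<in> {1..n}" "p ^ e dvd a"
    using prime_power_dvd_LcmD[of "{1..n}" p e] assms(1) False by auto
  then show ?thesis by (auto dest: dvd_imp_le)
qed

lemma prod_primes_dvd:
  fixes N :: nat
  assumes "finite A" "\<And>p. p \<in> A \<Longrightarrow> prime p \<and> p dvd N"
  shows "\<Prod>A dvd N"
  using assms
proof (induction A rule: finite_induct)
  case (insert p A)
  have "coprime p (\<Prod>A)"
    using insert by (intro prod_coprime_right) (metis insertCI primes_coprime)
  then show ?case using insert by (auto intro: divides_mult)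
qed auto

text \<open>The two middle coefficients of the row are equal, so each is at most half the row sum
  \<open>2 * 4 ^ m\<close>.\<close>

lemma central_binomial_odd_le: "(2 * m + 1) choose m \<le> 4 ^ m"
proof -
  have "2 * ((2 * m + 1) choose m) = (\<Sum>k\<in>{m, m + 1}. (2 * m + 1) choose k)"
    using binomial_symmetric[of m "2 * m + 1"] by simp
  also have "\<dots> \<le> (\<Sum>k\<le>2 * m + 1. (2 * m + 1) choose k)"
    by (rule sum_mono2) auto
  also have "\<dots> = 2 * 4 ^ m" using choose_row_sum[of "2 * m + 1"] by (simp only: power_add power_mult) simp
  finally show ?thesis by simp
qed

text \<open>Erdos' induction: an even \<open>n > 2\<close> is not prime, so \<open>n - 1\<close> has
  the same primorial; for \<open>n = 2 * m + 1\<close> the primes in \<open>(m + 1, n]\<close> all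
  divide \<open>n choose m\<close>, which is at most \<open>4 ^ m\<close>.\<close>

lemma primorial_le: "\<Prod>{p. prime p \<and> p \<le> n} \<le> 4 ^ n"
proof (induction n rule: less_induct)
  case (less n)
  have fin: "finite {p. prime p \<and> p \<le> k}" for k :: nat
    by (rule finite_subset[of _ "{..k}"]) auto
  have "n \<le> 1 \<or> n = 2 \<or> n > 2" by linarith
  then consider "n \<le> 1" | "n = 2" | "n > 2" "even n" | "n > 2" "odd n" by blast
  then show ?case
  proof cases
    case 1
    then have "{p. prime p \<and> p \<le> n} = {}" by (auto dest: prime_gt_1_nat)
    then show ?thesis by (simp only: prod.empty) simp
  next
    case 2
    then have "{p. prime p \<and> p \<le> n} = {2}" by (auto dest: prime_ge_2_nat)
    then show ?thesis using 2 by simp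
  next
    case 3
    have "\<not> prime n" using 3 prime_odd_nat by blast
    then have "p \<le> n \<longleftrightarrow> p \<le> n - 1" if "prime p" for p
      using that 3(1) by (cases "p = n") auto
    then have "{p. prime p \<and> p \<le> n} = {p. prime p \<and> p \<le> n - 1}" by blast
    then have "\<Prod>{p. prime p \<and> p \<le> n} \<le> 4 ^ (n - 1)" using less[of "n - 1"] 3 by simp
    also have "\<dots> \<le> 4 ^ n" by (rule power_increasing) auto
    finally show ?thesis .
  next
    case 4
    then obtain m where m: "n = 2 * m + 1" by (elim oddE)
    let ?B = "{p. prime p \<and> m + 1 < p \<and> p \<le> n}"
    have B: "finite ?B" using fin[of n] by (rule rev_finite_subset) auto
    have "\<Prod>?B dvd (n choose m)"
    proof (rule prod_primes_dvd[OF B], safe)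
      fix p assume p: "prime p" "m + 1 < p" "p \<le> n"
      have "p dvd fact m * fact (n - m) * (n choose m)"
        using p m by (subst binomial_fact_lemma) (auto simp: prime_dvd_fact_iff simp del: fact_Suc)
      then show "p dvd (n choose m)"
        using p m by (auto simp: prime_dvd_mult_iff prime_dvd_fact_iff simp del: fact_Suc)
    qed
    then have "\<Prod>?B \<le> 4 ^ m"
      using central_binomial_odd_le[of m] m by (auto dest!: dvd_imp_le simp: zero_less_binomial)
    moreover have "{p. prime p \<and> p \<le> n} = {p. prime p \<and> p \<le> m + 1} \<union> ?B"
      using m by auto
    then have "\<Prod>{p. prime p \<and> p \<le> n} = \<Prod>{p. prime p \<and> p \<le> m + 1} * \<Prod>?B"
      using fin B by (simp only:) (rule prod.union_disjoint, auto)
    ultimately have "\<Prod>{p. prime p \<and> p \<le> n} \<le> 4 ^ (m + 1) * 4 ^ m"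
      using less[of "m + 1"] m 4 by (simp add: mult_mono)
    then show ?thesis using m by (simp add: power_add mult_2)
  qed
qed

text \<open>Up to \<open>2 * n\<close> only \<open>p\<close> and \<open>2 * p\<close> are multiples
  of \<open>p\<close>, each with a single factor \<open>p\<close> because \<open>p\<close> is odd.
  The two copies of \<open>fact n\<close> in the denominator cancel both.\<close>

lemma prime_not_dvd_central_binomial:
  assumes p: "prime p" "p \<ge> 3" "p \<le> n" "2 * n < 3 * p"
  shows "\<not> p dvd ((2 * n) choose n)"
proof
  assume "p dvd ((2 * n) choose n)"
  then have v: "multiplicity p ((2 * n) choose n) \<ge> 1"
    using p by (simp add: multiplicity_geI)
  have mf: "multiplicity p (fact k :: nat) = (\<Sum>i\<in>{1..k}. multiplicity p i)" for k
    unfolding fact_prod using p(1)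
    by (simp add: prime_elem_multiplicity_prod_distrib)
  have "(\<Sum>i\<in>{p}. multiplicity p i) \<le> multiplicity p (fact n :: nat)"
    unfolding mf using p by (intro sum_mono2) auto
  then have n: "multiplicity p (fact n :: nat) \<ge> 1" using p by simp
  have "multiplicity p i = 0" if "i \<in> {1..2 * n} - {p, 2 * p}" for i
  proof (rule not_dvd_imp_multiplicity_0, rule)
    assume "p dvd i"
    then obtain c where c: "i = p * c" by (auto elim: dvdE)
    then have "p * c \<le> 2 * n" "c \<noteq> 0" using that by auto
    with p(4) have "p * c < p * 3" by linarith
    then have "c < 3" by simp
    with \<open>c \<noteq> 0\<close> have "c = 1 \<or> c = 2" by auto
    then show False using c that by auto
  qed
  then have "multiplicity p (fact (2 * n) :: nat) = (\<Sum>i\<in>{p, 2 * p}. multiplicity p i)"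
    unfolding mf using p by (intro sum.mono_neutral_right) auto
  also have "multiplicity p (2 * p) = multiplicity p 2 + multiplicity p p"
    using p by (intro prime_elem_multiplicity_mult_distrib) auto
  then have "(\<Sum>i\<in>{p, 2 * p}. multiplicity p i) = 2"
    using p by (simp add: not_dvd_imp_multiplicity_0 nat_dvd_not_less)
  finally have 2: "multiplicity p (fact (2 * n) :: nat) = 2" .
  have "fact (2 * n) = (fact n * fact n * ((2 * n) choose n) :: nat)"
    using binomial_fact_lemma[of n "2 * n"] by simp
  then have "multiplicity p (fact (2 * n) :: nat) =
      multiplicity p (fact n :: nat) + multiplicity p (fact n :: nat) + multiplicity p ((2 * n) choose n)"
    using p(1) by (simp add: prime_elem_multiplicity_mult_distrib)
  with 2 n v show False by simp
qed

subsection \<open>Two primes in a dyadic interval\<close>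

text \<open>The right side is the line through the origin and \<open>(32, ln 32)\<close>. Its slope
  is at least the derivative \<open>1 / 32\<close> of the logarithm at 32, so concavity keeps
  \<open>ln\<close> below it from there on.\<close>

lemma ln_le_of_ge_32:
  fixes y :: real
  assumes "y \<ge> 32"
  shows "ln y \<le> 5 * ln 2 * (y / 32)"
proof -
  have "ln (y / 32) \<le> y / 32 - 1" using assms by (intro ln_le_minus_one) auto
  also have "\<dots> \<le> 5 * ln 2 * (y / 32 - 1)"
  proof -
    have "ln (2::real) \<ge> 1 / 2" using ln_add_one_self_le_self2[of "- 1 / 2"] by (simp add: ln_div)
    then show ?thesis using assms mult_right_mono[of 1 "5 * ln 2" "y / 32 - 1"] by simp
  qed
  finally have "ln (y / 32) \<le> 5 * ln 2 * (y / 32) - 5 * ln 2" by (simp add: algebra_simps)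
  moreover have "ln (y / 32) = ln y - 5 * ln 2"
    using assms ln_realpow[of 2 5] by (simp add: ln_div)
  ultimately show ?thesis by simp
qed

text \<open>
  Erdos' factorisation of the central binomial coefficient: \<open>S\<close> counts its prime factors up to
  \<open>sqrt (2 * n)\<close>; the extra factor \<open>2 * n\<close> allows for one prime above \<open>n\<close>.
\<close>

lemma central_binomial_le_if_few_primes:
  assumes n: "n \<ge> 6" and few: "\<And>p r. prime p \<Longrightarrow> prime r \<Longrightarrow> n < p \<Longrightarrow> p < r \<Longrightarrow> r \<le> 2 * n \<Longrightarrow> False"
  shows "\<exists>S. S\<^sup>2 \<le> 2 * n \<and> ((2 * n) choose n) \<le> (2 * n) ^ (S + 1) * 4 ^ (2 * n div 3)"
proof -
  let ?C = "(2 * n) choose n"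
  let ?f = "\<lambda>p. p ^ multiplicity p ?C"
  define P where "P = prime_factors ?C"
  \<comment> \<open>Each prime power is at most \<open>2 * n\<close>, which suffices for
    \<open>P1\<close>. Primes in \<open>P2\<close> and \<open>P3\<close> occur once, as
    \<open>p\<^sup>2\<close> exceeds that bound; those in \<open>P2\<close> are at most
    \<open>2 * n / 3\<close> and fall under the primorial bound, and \<open>P3\<close> has at most
    one element.\<close>
  define P1 where "P1 = {p \<in> P. p\<^sup>2 \<le> 2 * n}"
  define P2 where "P2 = {p \<in> P. p\<^sup>2 > 2 * n \<and> p \<le> n}"
  define P3 where "P3 = {p \<in> P. p\<^sup>2 > 2 * n \<and> p > n}"
  have fin: "finite P1" "finite P2" "finite P3" unfolding P1_def P2_def P3_def P_def by auto
  have C: "?C > 0" by simp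
  have prime: "prime p" "p dvd ?C" if "p \<in> P" for p using that unfolding P_def by auto
  have le: "?f p \<le> 2 * n" if "p \<in> P" for p
    using prime(1)[OF that] n by (intro prime_power_dvd_binomial_le[of p _ "2 * n" n] multiplicity_dvd) auto
  have mult: "multiplicity p ?C = 1" if "p \<in> P" "p\<^sup>2 > 2 * n" for p
  proof (rule antisym)
    show "1 \<le> multiplicity p ?C" using prime[OF that(1)] C by (intro multiplicity_geI) auto
    show "multiplicity p ?C \<le> 1"
    proof (rule ccontr)
      assume "\<not> ?thesis"
      then have "p\<^sup>2 \<le> ?f p" using prime_gt_0_nat[OF prime(1)[OF that(1)]] by (intro power_increasing) auto
      with le[OF that(1)] that(2) show False by simp
    qed
  qed
  define S where "S = card P1"
  have "S\<^sup>2 \<le> 2 * n"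
  proof (cases "P1 = {}")
    case False
    \<comment> \<open>A set of positive integers has at most as many elements as its maximum, and
      here the square of the maximum is at most \<open>2 * n\<close>.\<close>
    have "P1 \<subseteq> {1..Max P1}"
      using fin(1) prime unfolding P1_def by (auto simp: Suc_le_eq prime_gt_0_nat)
    then have "S \<le> Max P1" using card_mono[of "{1..Max P1}" P1] unfolding S_def by simp
    moreover have "Max P1 \<in> P1" using False fin by simp
    then have "(Max P1)\<^sup>2 \<le> 2 * n" unfolding P1_def by simp
    ultimately show ?thesis by (meson order_trans power_mono zero_le)
  qed (simp add: S_def)
  moreover have "?C \<le> (2 * n) ^ (S + 1) * 4 ^ (2 * n div 3)"
  proof -
    have "(\<Prod>p\<in>P1. ?f p) \<le> (\<Prod>p\<in>P1. 2 * n)"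
      using le unfolding P1_def by (intro prod_mono) auto
    then have 1: "(\<Prod>p\<in>P1. ?f p) \<le> (2 * n) ^ S" by (simp add: S_def)
    have "(\<Prod>p\<in>P2. ?f p) = \<Prod>P2"
      using mult unfolding P2_def by (intro prod.cong) auto
    also have "\<dots> dvd \<Prod>{p. prime p \<and> p \<le> 2 * n div 3}"
    proof (rule prod_dvd_prod_subset)
      show "finite {p::nat. prime p \<and> p \<le> 2 * n div 3}"
        by (rule finite_subset[of _ "{..2 * n div 3}"]) auto
      show "P2 \<subseteq> {p. prime p \<and> p \<le> 2 * n div 3}"
      proof
        fix p assume p: "p \<in> P2"
        then have "p \<in> P" "p\<^sup>2 > 2 * n" "p \<le> n" by (auto simp: P2_def)
        moreover have "p \<noteq> 2" using \<open>p\<^sup>2 > 2 * n\<close> n by auto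
        then have "p \<ge> 3" using prime_ge_2_nat[OF prime(1)[OF \<open>p \<in> P\<close>]] by simp
        ultimately have "\<not> 2 * n < 3 * p" using prime prime_not_dvd_central_binomial by blast
        then show "p \<in> {p. prime p \<and> p \<le> 2 * n div 3}" using prime \<open>p \<in> P\<close> by auto
      qed
    qed
    finally have "(\<Prod>p\<in>P2. ?f p) \<le> \<Prod>{p. prime p \<and> p \<le> 2 * n div 3}"
      by (rule dvd_imp_le) (auto intro!: prod_pos prime_gt_0_nat)
    then have 2: "(\<Prod>p\<in>P2. ?f p) \<le> 4 ^ (2 * n div 3)"
      using primorial_le[of "2 * n div 3"] by (rule order_trans)
    have "p = r" if "p \<in> P3" "r \<in> P3" for p r
    proof -
      have "p \<in> P" "r \<in> P" "p > n" "r > n" using that by (auto simp: P3_def)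
      moreover have "p \<le> 2 * n" "r \<le> 2 * n" using le mult that by (fastforce simp: P3_def)+
      ultimately show ?thesis using few[of p r] few[of r p] prime by (metis linorder_neqE_nat)
    qed
    then have "P3 = {} \<or> (\<exists>p. P3 = {p})" by blast
    then have 3: "(\<Prod>p\<in>P3. ?f p) \<le> 2 * n"
    proof
      assume "\<exists>p. P3 = {p}"
      then obtain p where "P3 = {p}" by blast
      moreover then have "p \<in> P" unfolding P3_def by auto
      ultimately show ?thesis using le by simp
    qed (use n in simp)
    have "?C = (\<Prod>p\<in>P. ?f p)" unfolding P_def using C by (intro prime_factorization_nat)
    also have "P = P1 \<union> (P2 \<union> P3)" by (auto simp: P1_def P2_def P3_def)
    also have "(\<Prod>p\<in>\<dots>. ?f p) = (\<Prod>p\<in>P1. ?f p) * (\<Prod>p\<in>P2 \<union> P3. ?f p)"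
      using fin by (intro prod.union_disjoint) (auto simp: P1_def P2_def P3_def)
    also have "(\<Prod>p\<in>P2 \<union> P3. ?f p) = (\<Prod>p\<in>P2. ?f p) * (\<Prod>p\<in>P3. ?f p)"
      using fin by (intro prod.union_disjoint) (auto simp: P2_def P3_def)
    also have "(\<Prod>p\<in>P1. ?f p) * ((\<Prod>p\<in>P2. ?f p) * (\<Prod>p\<in>P3. ?f p))
        \<le> (2 * n) ^ S * (4 ^ (2 * n div 3) * (2 * n))"
      using 1 2 3 by (intro mult_mono) auto
    finally show ?thesis by (simp add: mult_ac)
  qed
  ultimately show ?thesis by blast
qed

text \<open>The central binomial coefficient is at least \<open>4 ^ n / (2 * n)\<close>. The upper
  bound for few primes lacks a factor of about \<open>4 ^ (n / 3)\<close>, which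
  \<open>(2 * n) ^ (S + 2)\<close> with \<open>S\<close> at most \<open>sqrt (2 * n)\<close> cannot
  make up.\<close>

lemma two_primes_large:
  fixes n :: nat
  assumes n: "n \<ge> 512"
  shows "\<exists>p r. prime p \<and> prime r \<and> n < p \<and> p < r \<and> r \<le> 2 * n"
proof (rule ccontr)
  assume "\<not> ?thesis"
  then obtain S where S: "S\<^sup>2 \<le> 2 * n"
    and C: "((2 * n) choose n) \<le> (2 * n) ^ (S + 1) * 4 ^ (2 * n div 3)"
    using central_binomial_le_if_few_primes[of n] n by auto
  \<comment> \<open>With \<open>ln y\<close> replaced by its linear bound, the comparison becomes
    quadratic in \<open>y\<close> and forces \<open>y \<le> 30\<close>, whereas
    \<open>n \<ge> 512\<close> gives \<open>y \<ge> 32\<close>.\<close>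
  define y where "y = sqrt (2 * real n)"
  have y2: "y\<^sup>2 = 2 * real n" by (simp add: y_def)
  have y: "y \<ge> 32" unfolding y_def using n by (intro real_le_rsqrt) simp
  have "(real S)\<^sup>2 \<le> real (2 * n)" using S by (metis of_nat_le_iff of_nat_power)
  then have Sy: "real S \<le> y" unfolding y_def by (intro real_le_rsqrt) simp
  have "4 ^ n / (2 * real n) \<le> real ((2 * n) choose n)"
    using n by (intro central_binomial_lower_bound) auto
  also have "\<dots> \<le> real ((2 * n) ^ (S + 1) * 4 ^ (2 * n div 3))" using C by (simp only: of_nat_le_iff)
  also have "\<dots> = (2 * real n) ^ (S + 1) * 4 ^ (2 * n div 3)" by simp
  finally have "4 ^ n \<le> (2 * real n) ^ (S + 2) * 4 ^ (2 * n div 3)"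
    using n by (simp add: field_simps)
  then have "ln (4 ^ n) \<le> ln ((2 * real n) ^ (S + 2) * 4 ^ (2 * n div 3))"
    using n by (subst ln_le_cancel_iff) auto
  also have "\<dots> = real (S + 2) * ln (2 * real n) + real (2 * n div 3) * ln 4"
  proof -
    have pos: "0 < (2 * real n) ^ (S + 2)" "0 < (4::real) ^ (2 * n div 3)" using n by auto
    show ?thesis unfolding ln_mult_pos[OF pos] ln_realpow ..
  qed
  also have "ln (4 ^ n) = real n * ln (4::real)" by (rule ln_realpow)
  also have "ln (4::real) = 2 * ln 2" using ln_realpow[of 2 2] by simp
  also have "ln (2 * real n) = 2 * ln y" unfolding y2[symmetric] using y by (subst ln_realpow) auto
  finally have "real n * (2 * ln 2) \<le> real (S + 2) * (2 * ln y) + real (2 * n div 3) * (2 * ln 2)" .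
  also have "\<dots> \<le> (y + 2) * (2 * (5 * ln 2 * (y / 32))) + (2 * real n / 3) * (2 * ln 2)"
    using Sy y ln_le_of_ge_32[OF y] by (intro add_mono mult_mono) auto
  also have "\<dots> = ((y + 2) * (5 * y / 16) + 2 * y\<^sup>2 / 3) * ln 2"
    unfolding y2 by (simp add: field_simps)
  also have "real n * (2 * ln 2) = y\<^sup>2 * ln 2" by (simp add: y2)
  finally have "y\<^sup>2 \<le> (y + 2) * (5 * y / 16) + 2 * y\<^sup>2 / 3" by simp
  then have "y * (y - 30) \<le> 0" by (simp add: field_simps power2_eq_square)
  then show False using y by (simp add: mult_le_0_iff)
qed

lemma two_primes_between:
  fixes n :: nat
  assumes n: "n \<ge> 6"
  shows "\<exists>p r. prime p \<and> prime r \<and> n < p \<and> p < r \<and> r \<le> 2 * n"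
proof (rule ccontr)
  assume no: "\<not> ?thesis"
  \<comment> \<open>A pair of primes up to \<open>2 * n\<close> cannot lie wholly above
    \<open>n\<close>, so \<open>p \<le> n\<close>; this \<open>p\<close> serves as the next
    \<open>a\<close>.\<close>
  have *: "p \<le> n" if "a \<le> n" "prime p" "prime r" "p < r" "r \<le> 2 * a" for a p r
    using no that by (metis leI le_trans mult_le_mono2)
  \<comment> \<open>Landau's trick, with primes at most twice the one two places before\<close>
  have "7 \<le> n" using *[of 6 7 11] n by simp
  then have "11 \<le> n" using *[of 7 11 13] by simp
  then have "13 \<le> n" using *[of 11 13 19] by simp
  then have "19 \<le> n" using *[of 13 19 23] by simp
  then have "23 \<le> n" using *[of 19 23 37] by simp
  then have "37 \<le> n" using *[of 23 37 43] by simp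
  then have "43 \<le> n" using *[of 37 43 73] by simp
  then have "73 \<le> n" using *[of 43 73 83] by simp
  then have "83 \<le> n" using *[of 73 83 139] by simp
  then have "139 \<le> n" using *[of 83 139 163] by simp
  then have "163 \<le> n" using *[of 139 163 277] by simp
  then have "277 \<le> n" using *[of 163 277 317] by simp
  then have "317 \<le> n" using *[of 277 317 547] by simp
  then have "547 \<le> n" using *[of 317 547 631] by simp
  then have "n \<ge> 512" by simp
  from two_primes_large[OF this] no show False by contradiction
qed

text \<open>Here \<open>s / d\<close> stands for the ratio of a deficient number. With
  \<open>n\<close> its integer part, primes above \<open>n\<close> exceed the ratio, and two primes
  up to \<open>2 * n\<close> satisfy \<open>1 / p + 1 / r \<ge> 1 / n\<close>, which yields the last
  inequality.\<close>

lemma two_primes_above_ratio: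
  fixes s d :: nat
  assumes "d > 0" "3 * d \<le> s"
  shows "\<exists>p r. prime p \<and> prime r \<and> s < p * d \<and> p < r \<and> p * r * d < s * (p + r + 1)"
proof -
  define n where "n = s div d"
  have n: "n * d \<le> s" "s < (n + 1) * d"
    using assms(1) by (simp_all add: n_def dividend_less_div_times add.commute)
  have n3: "n \<ge> 3" unfolding n_def using assms by (simp add: less_eq_div_iff_mult_less_eq)
  have *: "\<exists>p r. prime p \<and> prime r \<and> s < p * d \<and> p < r \<and> p * r * d < s * (p + r + 1)"
    if "prime p" "prime r" "n < p" "p < r" "p * r < n * (p + r + 1)" for p r
  proof -
    have "(n + 1) * d \<le> p * d" using that by (intro mult_right_mono) auto
    then have "s < p * d" using n by linarith
    moreover have "p * r * d < n * (p + r + 1) * d" using that assms(1) by simp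
    then have "p * r * d < n * d * (p + r + 1)" by (simp only: mult_ac)
    moreover have "n * d * (p + r + 1) \<le> s * (p + r + 1)" using n by (intro mult_right_mono) auto
    ultimately show ?thesis using that by (metis order_less_le_trans)
  qed
  \<comment> \<open>For 3 and 5 the interval \<open>(n, 2 * n]\<close> holds only one prime; the
    second may exceed \<open>2 * n\<close> because the first is well below it.\<close>
  consider "n = 3" | "n = 4" | "n = 5" | "n \<ge> 6" using n3 by linarith
  then show ?thesis
  proof cases
    case 1 then show ?thesis using *[of 5 7] by simp
  next
    case 2 then show ?thesis using *[of 5 7] by simp
  next
    case 3 then show ?thesis using *[of 7 11] by simp
  next
    case 4
    then obtain p r where pr: "prime p" "prime r" "n < p" "p < r" "r \<le> 2 * n"
      using two_primes_between by blast
    have "p * r \<le> p * (2 * n)" "p * r \<le> 2 * n * r" using pr by (simp_all add: mult_mono)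
    then have "2 * (p * r) \<le> 2 * (n * (p + r))" by (simp only: algebra_simps)
    then have "p * r < n * (p + r + 1)" using n3 by (simp add: algebra_simps)
    then show ?thesis using * pr by blast
  qed
qed

subsection \<open>Deficient and abundant numbers\<close>

lemma divisors_mult_prime:
  fixes p :: nat
  assumes "prime p"
  shows "{d. d dvd n * p} = {d. d dvd n} \<union> (\<lambda>d. d * p) ` {d. d dvd n}"
proof (intro equalityI subsetI)
  fix d assume "d \<in> {d. d dvd n * p}"
  then obtain a b where ab: "d = a * b" "a dvd n" "b dvd p" using division_decomp by blast
  then have "b = 1 \<or> b = p" using assms by (auto simp: prime_nat_iff)
  with ab show "d \<in> {d. d dvd n} \<union> (\<lambda>d. d * p) ` {d. d dvd n}" by auto
qed auto

text \<open>The families \<open>d\<close> and \<open>d * p\<close> of divisors overlap when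
  \<open>p\<close> divides \<open>n\<close>, so the sum over both is in general only an upper
  bound.\<close>

lemma divisor_sigma_mult_prime_le:
  assumes "prime p" "n > 0"
  shows "divisor_sigma (n * p) \<le> divisor_sigma n * (p + 1)"
proof -
  have fin: "finite {d. d dvd n}" using assms by simp
  have "divisor_sigma (n * p) \<le> (\<Sum>d | d dvd n. d) + (\<Sum>d\<in>(\<lambda>d. d * p) ` {d. d dvd n}. d)"
    unfolding divisor_sigma_def divisors_mult_prime[OF assms(1)]
    using fin sum.union_inter[of "{d. d dvd n}" "(\<lambda>d. d * p) ` {d. d dvd n}" "\<lambda>d. d"] by simp
  also have "(\<Sum>d\<in>(\<lambda>d. d * p) ` {d. d dvd n}. d) = (\<Sum>d | d dvd n. d * p)"
    using assms by (subst sum.reindex) (auto simp: inj_on_def prime_gt_0_nat)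
  finally show ?thesis by (simp add: divisor_sigma_def sum_distrib_right[symmetric])
qed

lemma divisor_sigma_mult_prime:
  assumes "prime p" "n > 0" "\<not> p dvd n"
  shows "divisor_sigma (n * p) = divisor_sigma n * (p + 1)"
proof -
  have "divisor_sigma (n * p) = (\<Sum>d | d dvd n. d) + (\<Sum>d\<in>(\<lambda>d. d * p) ` {d. d dvd n}. d)"
    unfolding divisor_sigma_def divisors_mult_prime[OF assms(1)]
    using assms by (intro sum.union_disjoint) (auto dest: dvd_mult_right)
  also have "(\<Sum>d\<in>(\<lambda>d. d * p) ` {d. d dvd n}. d) = (\<Sum>d | d dvd n. d * p)"
    using assms by (subst sum.reindex) (auto simp: inj_on_def prime_gt_0_nat)
  finally show ?thesis by (simp add: divisor_sigma_def sum_distrib_right[symmetric])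
qed

text \<open>\<open>(x + 1) / x\<close> decreases in \<open>x\<close>, and the product formula for
  \<open>divisor_sigma\<close> is an upper bound at \<open>p\<close> but exact at the new prime
  \<open>q\<close>.\<close>

lemma abundant_replace_smaller_prime:
  assumes "prime p" "prime q" "q < p" "n > 0" "\<not> q dvd n" "abundant (n * p)"
  shows "abundant (n * q)"
proof -
  let ?s = "divisor_sigma n"
  have "2 * (n * p) < divisor_sigma (n * p)" using assms(6) by (simp add: abundant_def)
  also have "\<dots> \<le> ?s * (p + 1)" using assms by (intro divisor_sigma_mult_prime_le)
  finally have "2 * n * p * q < ?s * (p + 1) * q"
    using prime_gt_0_nat[OF assms(2)] by (simp add: mult.assoc)
  also have "\<dots> \<le> ?s * (q + 1) * p" using assms(3) by (simp add: algebra_simps mult_mono)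
  finally have "2 * n * q * p < ?s * (q + 1) * p" by (simp only: mult_ac)
  then have "2 * n * q < ?s * (q + 1)" by simp
  then show ?thesis
    using divisor_sigma_mult_prime[of q n] assms by (simp add: abundant_def mult.assoc)
qed

text \<open>
  A new prime \<open>p\<close> keeps \<open>n\<close> deficient iff \<open>p > s\<close>, and new primes \<open>p < r\<close> make it abundant iff
  \<open>p * r < s * (p + r + 1)\<close>. In that case the ratio of \<open>n * p\<close> exceeds \<open>r\<close>, hence \<open>p\<close>, so the step can
  be iterated.
\<close>

lemma deficient_extend:
  fixes i k n P :: nat
  assumes "i < k" "n > 0" "deficient n" "P \<ge> 3" "\<And>x. prime x \<Longrightarrow> x dvd n \<Longrightarrow> x \<le> P"
    and "P * (2 * n - divisor_sigma n) \<le> divisor_sigma n"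
  shows "\<exists>f. strict_mono_on {i..k} f \<and> (\<forall>l\<in>{i..k}. prime (f l) \<and> P < f l) \<and>
      (\<forall>x\<in>{i..<k}. deficient (n * (\<Prod>l=i..x. f l))) \<and> abundant (n * (\<Prod>l=i..k. f l))"
  using assms
proof (induction "k - i" arbitrary: i n P)
  case (Suc t)
  define s d where "s = divisor_sigma n" and "d = 2 * n - s"
  have d: "d > 0" "2 * n = s + d" using Suc.prems(3) by (auto simp: d_def s_def deficient_def)
  have Ps: "P * d \<le> s" using Suc.prems(6) by (simp add: s_def d_def)
  have "3 * d \<le> P * d" using Suc.prems(4) by simp
  then have "3 * d \<le> s" using Ps by linarith
  then obtain p r where pr: "prime p" "prime r" "s < p * d" "p < r" "p * r * d < s * (p + r + 1)"
    using two_primes_above_ratio d by blast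
  \<comment> \<open>The new prime exceeds \<open>P\<close> and hence every prime factor of
    \<open>n\<close>, so it is coprime to \<open>n\<close> and the sequence increases.\<close>
  have "P * d < p * d" using Ps pr by linarith
  then have Pp: "P < p" by simp
  then have pn: "\<not> p dvd n" using Suc.prems(5) pr by (meson not_le)
  have rn: "\<not> r dvd n" using Suc.prems(5)[of r] pr Pp by auto
  have pos: "p > 0" "r > 0" using pr by (auto simp: prime_gt_0_nat)
  have rnp: "\<not> r dvd n * p" using rn pr pos by (auto simp: prime_dvd_mult_iff dest: dvd_imp_le)
  have sp: "divisor_sigma (n * p) = s * (p + 1)"
    using divisor_sigma_mult_prime pn pr Suc.prems(2) by (simp add: s_def)
  \<comment> \<open>Writing \<open>2 * n\<close> as \<open>s + d\<close> cancels the common terms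
    and turns deficiency and abundance into the two inequalities in \<open>pr\<close>.\<close>
  have dp: "2 * (n * p) = (s + d) * p" by (simp add: d(2)[symmetric])
  have def_p: "deficient (n * p)"
    unfolding deficient_def sp dp using pr(3) by (simp add: algebra_simps)
  have spr: "divisor_sigma (n * p * r) = s * (p + 1) * (r + 1)"
    using divisor_sigma_mult_prime[of r "n * p"] rnp pr pos Suc.prems(2) by (simp add: sp)
  have "2 * (n * p * r) = (s + d) * p * r" by (simp only: d(2)[symmetric] mult.assoc)
  then have ab: "abundant (n * p * r)"
    unfolding abundant_def spr using pr(5) by (simp add: algebra_simps)
  show ?case
  proof (cases "t = 0")
    \<comment> \<open>Only two places remain, and \<open>p\<close> and \<open>r\<close> fill
      them.\<close>
    case True
    then have k: "k = Suc i" using Suc by simp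
    define f where "f = (\<lambda>l. if l = i then p else r)"
    have eq: "{i..k} = {i, Suc i}" "{i..<k} = {i}" using k by auto
    have "strict_mono_on {i..k} f" unfolding eq f_def using pr by (auto simp: strict_mono_on_def)
    moreover have "n * (\<Prod>l=i..k. f l) = n * p * r" unfolding eq by (simp add: f_def)
    ultimately show ?thesis
      using def_p ab pr Pp unfolding eq(2) by (intro exI[of _ f]) (auto simp: f_def mult.assoc)
  next
    case False
    \<comment> \<open>Only \<open>p\<close> is kept. Since \<open>r\<close> would make the product
      abundant, the new ratio is at least \<open>r\<close>, hence at least \<open>p\<close>: the
      invariant holds with \<open>p\<close> in place of \<open>P\<close>.\<close>
    have "p * (2 * (n * p) - divisor_sigma (n * p)) \<le> divisor_sigma (n * p)"
    proof -
      have "2 * (n * p * r) < divisor_sigma (n * p) * (r + 1)"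
        using ab unfolding abundant_def spr sp .
      then have "r * (2 * (n * p) - divisor_sigma (n * p)) \<le> divisor_sigma (n * p)"
        by (simp add: diff_mult_distrib2 algebra_simps)
      moreover have "p * (2 * (n * p) - divisor_sigma (n * p)) \<le> r * (2 * (n * p) - divisor_sigma (n * p))"
        using pr by (intro mult_right_mono) auto
      ultimately show ?thesis by (rule order_trans[rotated])
    qed
    moreover have "x \<le> p" if "prime x" "x dvd n * p" for x
      using that Suc.prems(5)[of x] pr Pp pos by (auto simp: prime_dvd_mult_iff dest: dvd_imp_le)
    moreover have "t = k - Suc i" "Suc i < k" using Suc.hyps(2) False by auto
    ultimately obtain f where f: "strict_mono_on {Suc i..k} f" "\<forall>l\<in>{Suc i..k}. prime (f l) \<and> p < f l"
      "\<forall>x\<in>{Suc i..<k}. deficient (n * p * (\<Prod>l=Suc i..x. f l))" "abundant (n * p * (\<Prod>l=Suc i..k. f l))"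
      using Suc.hyps(1)[of "Suc i" "n * p" p] def_p Suc.prems Pp by auto
    define g where "g = f(i := p)"
    have prod: "n * (\<Prod>l=i..x. g l) = n * p * (\<Prod>l=Suc i..x. f l)" if "i \<le> x" for x
    proof -
      have "(\<Prod>l=Suc i..x. g l) = (\<Prod>l=Suc i..x. f l)" by (intro prod.cong) (auto simp: g_def)
      then show ?thesis using that by (simp add: prod.atLeast_Suc_atMost[of i x] g_def mult_ac)
    qed
    have "strict_mono_on {i..k} g"
    proof (rule strict_mono_onI)
      fix x y assume "x \<in> {i..k}" "y \<in> {i..k}" "x < y"
      then show "g x < g y"
        using f(2) strict_mono_onD[OF f(1), of x y] by (cases "x = i") (auto simp: g_def)
    qed
    moreover have "\<forall>l\<in>{i..k}. prime (g l) \<and> P < g l"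
    proof
      fix l assume "l \<in> {i..k}"
      then show "prime (g l) \<and> P < g l"
        using f(2) pr Pp by (cases "l = i") (auto simp: g_def intro: less_trans)
    qed
    moreover have "deficient (n * (\<Prod>l=i..x. g l))" if "x \<in> {i..<k}" for x
    proof -
      have "i \<le> x" using that by simp
      then show ?thesis unfolding prod[OF \<open>i \<le> x\<close>] using that f(3) def_p by (cases "x = i") auto
    qed
    moreover have "abundant (n * (\<Prod>l=i..k. g l))" using f(4) Suc.prems(1) by (subst prod) auto
    ultimately show ?thesis by blast
  qed
qed simp

section \<open>Assembling the new sequence of primes\<close>

lemma prime_dvd_prod_primesD:
  fixes f :: "'a \<Rightarrow> nat"
  assumes "finite A" "prime x" "x dvd prod f A" "\<And>a. a \<in> A \<Longrightarrow> prime (f a)"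
  shows "x \<in> f ` A"
proof -
  obtain a where "a \<in> A" "x dvd f a" using assms by (auto simp: prime_dvd_prod_iff)
  then show ?thesis using assms(2,4) primes_dvd_imp_eq by blast
qed

theorem theorem3p7:
  fixes m k j q :: nat and p :: "nat \<Rightarrow> nat"
  assumes "m = (\<Prod>i=1..k. p i)"
    and "primitive_abundant m"
    and "\<forall>i\<in>{1..k}. prime (p i)"
    and "mono_on {1..k} p"
    and "p 0 = 1"
    and "1 \<le> j" and "j < k"
    and "prime q"
    and "p (j - 1) < q" and "q < p j"
    and "deficient ((\<Prod>i=1..j-1. p i) * q)"
  shows "\<exists>p' :: nat \<Rightarrow> nat. p' j = q \<and>
           (\<forall>i\<in>{j+1..k}. prime (p' i)) \<and> mono_on {j..k} p' \<and>
           abundant ((\<Prod>i=1..j-1. p i) * (\<Prod>i=j..k. p' i)) \<and>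
           (\<forall>i. j \<le> i \<and> i < k \<longrightarrow> deficient ((\<Prod>l=1..j-1. p l) * (\<Prod>l=j..i. p' l)))"
proof -
  define a where "a = (\<Prod>i=1..j-1. p i)"
  \<comment> \<open>The product starts at \<open>j + 1\<close>, so \<open>b j = 1\<close> and
    \<open>a * q * b j\<close> is the product assumed deficient.\<close>
  define b where "b x = (\<Prod>l=j+1..x. p l)" for x
  have prime: "prime (p i)" if "1 \<le> i" "i \<le> k" for i using assms(3) that by simp
  have mono: "p x \<le> p y" if "1 \<le> x" "x \<le> y" "y \<le> k" for x y
    using mono_onD[OF assms(4), of x y] that by simp
  have q_ge: "q \<ge> 2" using assms(8) by (rule prime_ge_2_nat)
  have a_pos: "a > 0" unfolding a_def using prime assms(7)
    by (intro prod_pos) (auto simp: prime_gt_0_nat)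
  have b_pos: "b x > 0" if "x \<le> k" for x unfolding b_def using prime that
    by (intro prod_pos) (auto simp: prime_gt_0_nat)
  have dvd_a: "x < q" if "prime x" "x dvd a" for x
  proof -
    have "x \<in> p ` {1..j-1}"
      by (rule prime_dvd_prod_primesD) (use that prime assms(7) in \<open>auto simp: a_def\<close>)
    then obtain i where "i \<in> {1..j-1}" "x = p i" by blast
    moreover have "j - 1 \<le> k" using assms(7) by simp
    ultimately show ?thesis using mono[of i "j - 1"] assms(9) by auto
  qed
  have dvd_b: "p j \<le> x \<and> x \<le> p y" if "prime x" "x dvd b y" "y \<le> k" for x y
  proof -
    have "x \<in> p ` {j+1..y}"
      by (rule prime_dvd_prod_primesD) (use that prime in \<open>auto simp: b_def\<close>)
    then obtain i where "i \<in> {j+1..y}" "x = p i" by blast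
    then show ?thesis using mono[of i y] mono[of j i] assms(6) that by auto
  qed
  have "{1..k} = {1..j-1} \<union> ({j} \<union> {j+1..k})" using assms(6,7) by auto
  then have "m = a * (p j * b k)"
    unfolding assms(1) a_def b_def
    by (simp only:) (subst prod.union_disjoint; use assms(6) in auto)
  then have "abundant (a * b k * p j)"
    using assms(2) by (simp add: primitive_abundant_def mult_ac)
  \<comment> \<open>Prime factors of \<open>a\<close> are below \<open>q\<close> and those of
    \<open>b k\<close> are at least \<open>p j > q\<close>; so \<open>q\<close> is new and may
    replace \<open>p j\<close>.\<close>
  moreover have "\<not> q dvd a * b k"
    using dvd_a[of q] dvd_b[of q k] assms(8,10) by (auto simp: prime_dvd_mult_iff)
  ultimately have "abundant (a * b k * q)"
    using abundant_replace_smaller_prime[of "p j" q "a * b k"] assms(6-10) prime a_pos b_pos by simp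
  then have ab: "abundant (a * q * b k)" by (simp only: mult_ac)
  have a_eq: "(\<Prod>i=1..j-1. p i) = a" by (simp add: a_def)
  have b_Suc: "b (Suc x) = b x * p (Suc x)" if "j \<le> x" for x using that by (simp add: b_def)
  \<comment> \<open>The sequence with \<open>q\<close> at \<open>j\<close>, the old primes before
    \<open>i\<close> and \<open>f\<close> from \<open>i\<close> on. For \<open>x < i\<close> the
    \<open>f\<close> product is empty and the minimum is \<open>x\<close>.\<close>
  have prod: "(\<Prod>l=j..x. if l = j then q else if l < i then p l else f l) = q * b (min x (i - 1)) * (\<Prod>l=i..x. f l)"
    if "j \<le> x" "j < i" for x i and f :: "nat \<Rightarrow> nat"
  proof -
    let ?g = "\<lambda>l. if l = j then q else if l < i then p l else f l"
    have "(\<Prod>l=j..x. ?g l) = q * (\<Prod>l=j+1..x. ?g l)"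
      using that(1) by (simp add: prod.atLeast_Suc_atMost)
    also have "{j+1..x} = {j+1..min x (i - 1)} \<union> {i..x}" using that by auto
    also have "(\<Prod>l\<in>\<dots>. ?g l) = (\<Prod>l=j+1..min x (i - 1). ?g l) * (\<Prod>l=i..x. ?g l)"
      using that by (intro prod.union_disjoint) auto
    also have "(\<Prod>l=j+1..min x (i - 1). ?g l) = b (min x (i - 1))"
      unfolding b_def using that by (intro prod.cong) auto
    also have "(\<Prod>l=i..x. ?g l) = (\<Prod>l=i..x. f l)"
      using that by (intro prod.cong) auto
    finally show ?thesis by (simp only: mult.assoc)
  qed
  \<comment> \<open>The first place where keeping the old primes loses deficiency; \<open>k\<close>
    is a candidate because \<open>a * q * b k\<close> is abundant.\<close>
  define i where "i = (LEAST x. j < x \<and> \<not> deficient (a * q * b x))"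
  have "j < k \<and> \<not> deficient (a * q * b k)"
    using ab assms(7) by (simp add: abundant_def deficient_def)
  then have "j < i \<and> \<not> deficient (a * q * b i)" "i \<le> k"
    unfolding i_def by (rule LeastI, rule Least_le)
  then have i: "j < i" "\<not> deficient (a * q * b i)" "i \<le> k" by auto
  have def_less: "deficient (a * q * b x)" if "j \<le> x" "x < i" for x
  proof (cases "x = j")
    case True
    then show ?thesis using assms(11) by (simp add: b_def a_def)
  next
    case False
    then show ?thesis using not_less_Least[OF that(2)[unfolded i_def]] that(1) by simp
  qed
  show ?thesis
  proof (cases "i = k")
    \<comment> \<open>The old primes stay up to the end, where \<open>ab\<close> supplies abundance
      and not merely non-deficiency.\<close>
    case True
    define p' where "p' = p(j := q)"
    have p': "(\<Prod>l=j..x. p' l) = q * b x" if "j \<le> x" for x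
    proof -
      have "(\<Prod>l=j+1..x. p' l) = b x" unfolding b_def by (intro prod.cong) (auto simp: p'_def)
      then show ?thesis using that by (simp add: prod.atLeast_Suc_atMost[of j x] p'_def)
    qed
    have "mono_on {j..k} p'"
    proof (rule mono_onI)
      fix x y assume "x \<in> {j..k}" "y \<in> {j..k}" "x \<le> y"
      then show "p' x \<le> p' y"
        using mono[of x y] mono[of j y] assms(6,10) by (auto simp: p'_def)
    qed
    moreover have "\<forall>l\<in>{j+1..k}. prime (p' l)" using prime by (auto simp: p'_def)
    ultimately show ?thesis
      unfolding a_eq using p' ab def_less True assms(7)
      by (intro exI[of _ p']) (auto simp: p'_def mult.assoc)
  next
    case False
    define n where "n = a * q * b (i - 1)"
    have ik: "i < k" using i False by simp
    have n_pos: "n > 0" unfolding n_def using a_pos b_pos[of "i - 1"] ik q_ge by simp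
    have def_n: "deficient n" unfolding n_def using def_less i by simp
    have ni: "a * q * b i = n * p i"
      using b_Suc[of "i - 1"] i by (simp add: n_def mult.assoc)
    have pi: "prime (p i)" "q < p i" "p j \<le> p i"
      using prime[of i] mono[of j i] assms(6,10) i by auto
    \<comment> \<open>Non-deficiency after appending \<open>p i\<close> means that the ratio of
      \<open>n\<close> is at least \<open>p i\<close>; the upper bound on
      \<open>divisor_sigma\<close> covers a repeated \<open>p i\<close>. Thus \<open>p i\<close> can
      serve as \<open>P\<close>, and place \<open>i\<close> itself is refilled by a larger
      prime.\<close>
    have "2 * (n * p i) \<le> divisor_sigma n * (p i + 1)"
      using i(2) divisor_sigma_mult_prime_le[OF pi(1) n_pos] unfolding ni deficient_def by linarith
    then have "p i * (2 * n - divisor_sigma n) \<le> divisor_sigma n"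
      by (simp add: diff_mult_distrib2 algebra_simps)
    moreover have "x \<le> p i" if "prime x" "x dvd n" for x
    proof -
      have "x dvd a \<or> x dvd q \<or> x dvd b (i - 1)" using that unfolding n_def by (auto simp: prime_dvd_mult_iff)
      moreover have "p (i - 1) \<le> p i" "i - 1 \<le> k" using mono[of "i - 1" i] i assms(6) by simp_all
      ultimately show ?thesis
        using dvd_a[of x] dvd_b[of x "i - 1"] that pi ik assms(8) by (auto dest: primes_dvd_imp_eq)
    qed
    moreover have "p i \<ge> 3" using pi q_ge by simp
    ultimately obtain f where f: "strict_mono_on {i..k} f" "\<forall>l\<in>{i..k}. prime (f l) \<and> p i < f l"
      "\<forall>x\<in>{i..<k}. deficient (n * (\<Prod>l=i..x. f l))" "abundant (n * (\<Prod>l=i..k. f l))"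
      using deficient_extend[OF ik n_pos def_n, of "p i"] by auto
    define p' where "p' = (\<lambda>l. if l = j then q else if l < i then p l else f l)"
    have p': "a * (\<Prod>l=j..x. p' l) = (if x < i then a * q * b x else n * (\<Prod>l=i..x. f l))" if "j \<le> x" for x
      using prod[OF that i(1), of f] that i by (auto simp: p'_def n_def min_def mult.assoc)
    have "mono_on {j..k} p'"
    proof (rule mono_onI)
      fix x y assume xy: "x \<in> {j..k}" "y \<in> {j..k}" "x \<le> y"
      consider "y < i" | "x < i" "i \<le> y" | "i \<le> x" by linarith
      then show "p' x \<le> p' y"
      proof cases
        case 1
        then show ?thesis using xy mono[of x y] mono[of j y] assms(6,10) by (auto simp: p'_def)
      next
        \<comment> \<open>Across the seam: entries before \<open>i\<close> are at most
          \<open>p i\<close>, and the appended primes exceed it.\<close>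
        case 2
        then have "p i < f y" using f(2) xy by simp
        then show ?thesis using 2 xy mono[of x i] pi i assms(6) by (auto simp: p'_def)
      next
        case 3
        then show ?thesis using xy i strict_mono_onD[OF f(1), of x y]
          by (cases "x = y") (auto simp: p'_def)
      qed
    qed
    moreover have "\<forall>l\<in>{j+1..k}. prime (p' l)" using prime f(2) by (auto simp: p'_def)
    moreover have "abundant (a * (\<Prod>l=j..k. p' l))" using p'[of k] f(4) ik assms(7) by simp
    moreover have "deficient (a * (\<Prod>l=j..x. p' l))" if "j \<le> x" "x < k" for x
      using p'[of x] f(3) def_less that by auto
    ultimately show ?thesis unfolding a_eq by (intro exI[of _ p']) (auto simp: p'_def)
  qed
qed

end
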